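(* There exists a realtime quantum finite automaton with a push-only stack (RT-QFA-POS) that recognizes the language $L_{twin}=\{wcw \mid w\in\{a,b\}^*\}$ over the alphabet $\{a,b,c\}$ with negative one-sided error bound $\frac12$.
   Context: Realtime processing: for an input $w\in\Sigma^*$ (where $\Sigma$ is a finite alphabet not containing the end-markers ¢, \$), the input tape contains $\tilde w=$ ¢$w$\$. The machine reads $\tilde w$ from left to right, one symbol per step, and decides right after reading \$. Put $\tilde\Sigma=\Sigma\cup\{\text{¢},\$\}$. RT-QFA-POS: a tuple $(Q,\Sigma,\Gamma,\Omega,\delta,q_1,Q_a)$ with finite state set $Q$, initial state $q_1$, accepting states $Q_a\subseteq Q$, finite register alphabet $\Omega$, and a finite write-only tape alphabet $\Gamma$ containing the blank symbol $\#$ and the empty symbol $\varepsilon$. In state $q$ reading $\sigma\in\tilde\Sigma$, the machine moves to $q'$, writes $\gamma\in\Gamma$ on the write-only tape and $\omega\in\Omega$ in the register with amplitude $\delta(q,\sigma,q',\gamma,\omega)\in\mathbb C$. The write-only tape head is one-way: it moves one square to the right if the written symbol differs from $\varepsilon$, and stays put (nothing being written) if $\gamma=\varepsilon$. The write-only tape is never read. A configuration consists of the state, the input head position and the content of the write-only tape (the register is not part of it, and is reset to a fixed initial symbol before every step). For a given input let $\mathcal C$ be the set of attainable configurations, and for $\omega\in\Omega$ let $E_\omega$ be the matrix of one-step amplitudes between configurations with $\omega$ written in the register. The machine must be well-formed: $\sum_{\omega}E_\omega^\dagger E_\omega=I$ for every input. The state evolves from the initial configuration (write-only tape blank) by $\rho\mapsto\sum_\omega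 E_\omega\rho E_\omega^\dagger$ in each step, and $f_{\mathcal M}(w)$ is the probability that, after \$ is processed, a measurement of the internal state gives a state in $Q_a$. $L$ is recognized by $\mathcal M$ with negative one-sided error bound $\epsilon\in[0,1)$ if $f_{\mathcal M}(w)=1$ for all $w\in L$ and $f_{\mathcal M}(w)\le\epsilon$ for all $w\in\Sigma^*\setminus L$. *)

theory Defs
  imports Complex_Main
begin

section \<open>Realtime quantum finite automata with a push-only stack\<close>

datatype 's tape_symbol = LeftEnd | Letter 's | RightEnd

definition tilde :: "'s list \<Rightarrow> 's tape_symbol list" where
  "tilde w = LeftEnd # map Letter w @ [RightEnd]"

record ('q, 's, 'g, 'o) rt_qfa_pos =
  states :: "'q set"
  input_alphabet :: "'s set"
  tape_alphabet :: "'g set"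
  blank_sym :: 'g
  empty_sym :: 'g
  register_alphabet :: "'o set"
  delta :: "'q \<Rightarrow> 's tape_symbol \<Rightarrow> 'q \<Rightarrow> 'g \<Rightarrow> 'o \<Rightarrow> complex"
  initial :: 'q
  accepting :: "'q set"

text \<open>
  A configuration consists of the state, the number of symbols of the input tape read so far
  (the input head position) and the content of the write-only tape. The head of that tape never
  moves back, so the content is given by the word of the non-empty symbols written so far (blank
  symbols that were explicitly written included); its length is the position of the head, all
  squares from there on are blank, and the entirely blank initial tape is \<open>[]\<close>.
\<close>

type_synonym ('q, 'g) config = "'q \<times> nat \<times> 'g list"

definition initial_config :: "('q, 's, 'g, 'o) rt_qfa_pos \<Rightarrow> ('q, 'g) config" where
  "initial_config M = (initial M, 0, [])"

definition push :: "('q, 's, 'g, 'o) rt_qfa_pos \<Rightarrow> 'g \<Rightarrow> 'g list \<Rightarrow> 'g list" where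
  "push M g t = (if g = empty_sym M then t else t @ [g])"

text \<open>
  \<open>E_op M w om c' c\<close> is the entry in row \<open>c'\<close> and column \<open>c\<close> of the matrix \<open>E\<^sub>o\<^sub>m\<close>.
  The sum below has at most one term, as \<open>push M g t\<close> determines \<open>g\<close>.
\<close>

definition E_op ::
  "('q, 's, 'g, 'o) rt_qfa_pos \<Rightarrow> 's list \<Rightarrow> 'o \<Rightarrow> ('q, 'g) config \<Rightarrow> ('q, 'g) config \<Rightarrow> complex"
where
  "E_op M w om = (\<lambda>(q', i', t') (q, i, t).
     if q \<in> states M \<and> q' \<in> states M \<and> i < length (tilde w) \<and> i' = Suc i
     then (\<Sum>g | g \<in> tape_alphabet M \<and> push M g t = t'. delta M q (tilde w ! i) q' g om)
     else 0)"

inductive_set attainable :: "('q, 's, 'g, 'o) rt_qfa_pos \<Rightarrow> 's list \<Rightarrow> ('q, 'g) config set"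
  for M :: "('q, 's, 'g, 'o) rt_qfa_pos" and w :: "'s list" where
  init: "initial_config M \<in> attainable M w"
| step: "c \<in> attainable M w \<Longrightarrow> om \<in> register_alphabet M \<Longrightarrow> E_op M w om c' c \<noteq> 0
    \<Longrightarrow> c' \<in> attainable M w"

text \<open>Matrices with rows and columns indexed by a set \<open>C\<close> of configurations.\<close>

definition mat_mul :: "'c set \<Rightarrow> ('c \<Rightarrow> 'c \<Rightarrow> complex) \<Rightarrow> ('c \<Rightarrow> 'c \<Rightarrow> complex) \<Rightarrow> 'c \<Rightarrow> 'c \<Rightarrow> complex"
  where "mat_mul C A B = (\<lambda>x y. \<Sum>z\<in>C. A x z * B z y)"

definition adjoint :: "('c \<Rightarrow> 'c \<Rightarrow> complex) \<Rightarrow> 'c \<Rightarrow> 'c \<Rightarrow> complex" where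
  "adjoint A = (\<lambda>x y. cnj (A y x))"

text \<open>
  A configuration in which the right end-marker has been read has no successor: its column is zero
  in every \<open>E\<^sub>o\<^sub>m\<close>. The completeness relation is therefore required on the attainable
  configurations from which a step is taken.
\<close>

definition well_formed :: "('q, 's, 'g, 'o) rt_qfa_pos \<Rightarrow> bool" where
  "well_formed M \<longleftrightarrow> (\<forall>w \<in> lists (input_alphabet M).
     \<forall>c \<in> attainable M w. \<forall>d \<in> attainable M w.
       fst (snd c) < length (tilde w) \<longrightarrow> fst (snd d) < length (tilde w) \<longrightarrow>
       (\<Sum>om\<in>register_alphabet M.
          mat_mul (attainable M w) (adjoint (E_op M w om)) (E_op M w om) c d)
       = (if c = d then 1 else 0))"

definition is_rt_qfa_pos :: "('q, 's, 'g, 'o) rt_qfa_pos \<Rightarrow> bool" where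
  "is_rt_qfa_pos M \<longleftrightarrow>
     finite (states M) \<and> finite (input_alphabet M) \<and>
     finite (tape_alphabet M) \<and> finite (register_alphabet M) \<and>
     blank_sym M \<in> tape_alphabet M \<and> empty_sym M \<in> tape_alphabet M \<and> blank_sym M \<noteq> empty_sym M \<and>
     initial M \<in> states M \<and> accepting M \<subseteq> states M \<and>
     well_formed M"

text \<open>All sums over attainable configurations are finite.\<close>

lemma finite_attainable:
  assumes "is_rt_qfa_pos M"
  shows "finite (attainable M w)"
proof -
  let ?n = "length (tilde w)"
  let ?T = "{t. set t \<subseteq> tape_alphabet M \<and> length t \<le> ?n}"
  have *: "fst c \<in> states M \<and> fst (snd c) \<le> ?n \<and> set (snd (snd c)) \<subseteq> tape_alphabet M \<and>
      length (snd (snd c)) \<le> fst (snd c)" if "c \<in> attainable M w" for c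
    using that
  proof induction
    case init
    then show ?case using assms by (simp add: initial_config_def is_rt_qfa_pos_def)
  next
    case (step c om c')
    obtain q i t q' i' t' where c: "c = (q, i, t)" "c' = (q', i', t')"
      by (metis prod_cases3)
    from step.hyps(3) have nz: "q' \<in> states M" "i < ?n" "i' = Suc i"
      "(\<Sum>g | g \<in> tape_alphabet M \<and> push M g t = t'. delta M q (tilde w ! i) q' g om) \<noteq> 0"
      unfolding c E_op_def by (auto split: if_splits)
    from nz(4) obtain g where "g \<in> tape_alphabet M" "push M g t = t'"
      by (metis (mono_tags, lifting) mem_Collect_eq sum.neutral)
    then show ?case using step.IH nz(1-3) c by (auto simp: push_def split: if_splits)
  qed
  have "attainable M w \<subseteq> states M \<times> {..?n} \<times> ?T"
    using * by (force dest: le_trans)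
  moreover have "finite (states M \<times> {..?n} \<times> ?T)"
    using assms finite_lists_length_le[of "tape_alphabet M" ?n] by (simp add: is_rt_qfa_pos_def)
  ultimately show ?thesis by (rule finite_subset)
qed

definition evolve ::
  "('q, 's, 'g, 'o) rt_qfa_pos \<Rightarrow> 's list \<Rightarrow>
   (('q, 'g) config \<Rightarrow> ('q, 'g) config \<Rightarrow> complex) \<Rightarrow> ('q, 'g) config \<Rightarrow> ('q, 'g) config \<Rightarrow> complex"
where
  "evolve M w \<rho> = (\<lambda>c d. \<Sum>om\<in>register_alphabet M.
     mat_mul (attainable M w)
       (mat_mul (attainable M w) (E_op M w om) \<rho>) (adjoint (E_op M w om)) c d)"

definition initial_density ::
  "('q, 's, 'g, 'o) rt_qfa_pos \<Rightarrow> ('q, 'g) config \<Rightarrow> ('q, 'g) config \<Rightarrow> complex" where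
  "initial_density M = (\<lambda>c d. if c = initial_config M \<and> d = initial_config M then 1 else 0)"

definition final_density ::
  "('q, 's, 'g, 'o) rt_qfa_pos \<Rightarrow> 's list \<Rightarrow> ('q, 'g) config \<Rightarrow> ('q, 'g) config \<Rightarrow> complex" where
  "final_density M w = (evolve M w ^^ length (tilde w)) (initial_density M)"

text \<open>The diagonal entries of a density matrix are real, so taking \<open>Re\<close> loses nothing.\<close>

definition accept_prob :: "('q, 's, 'g, 'o) rt_qfa_pos \<Rightarrow> 's list \<Rightarrow> real" where
  "accept_prob M w = Re (\<Sum>c | c \<in> attainable M w \<and> fst c \<in> accepting M. final_density M w c c)"

definition recognizes_neg_one_sided ::
  "('q, 's, 'g, 'o) rt_qfa_pos \<Rightarrow> 's list set \<Rightarrow> real \<Rightarrow> bool" where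
  "recognizes_neg_one_sided M L \<epsilon> \<longleftrightarrow>
     0 \<le> \<epsilon> \<and> \<epsilon> < 1 \<and> L \<subseteq> lists (input_alphabet M) \<and>
     (\<forall>w \<in> L. accept_prob M w = 1) \<and>
     (\<forall>w \<in> lists (input_alphabet M) - L. accept_prob M w \<le> \<epsilon>)"

datatype abc = Sa | Sb | Sc

definition L_twin :: "abc list set" where
  "L_twin = {w @ [Sc] @ w | w. w \<in> lists {Sa, Sb}}"

end

theory Submission
  imports Defs
begin

text \<open>
  On the left end-marker the machine splits into two branches with equal amplitudes. One branch
  pushes the input before the first \<open>c\<close>, the other one the input after it. If the input has exactly
  one \<open>c\<close>, the branches reach the right end-marker in the states 3 and 4, where a Hadamard
  transform is applied. Equal tapes make the branches interfere, and the whole amplitude ends in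
  the accepting state 3; with different tapes there is no interference, and half of the
  probability is lost. On any other number of \<open>c\<close>s the states 3 and 4 are avoided altogether. Each
  step is an isometry, so a register with one symbol suffices and the state remains pure.
\<close>

section \<open>The machine\<close>

text \<open>
  The first branch is in the state 1, 3 or 5 after reading no, one or at least two letters \<open>c\<close>; the
  second one in the state 2, 4 or 6. Pushing takes place in the states 1 and 4. On the tape, 0 is
  the blank and 1 the empty symbol.
\<close>

definition half_amp :: complex where
  "half_amp = complex_of_real (1 / sqrt 2)"

text \<open>The separator \<open>Sc\<close> is sent to the empty symbol, so reading it leaves the
  tape unchanged even in a pushing state.\<close>

fun encode :: "abc \<Rightarrow> nat" where
  "encode Sa = 2"
| "encode Sb = 3"
| "encode Sc = 1"

fun out_sym :: "nat \<Rightarrow> abc tape_symbol \<Rightarrow> nat" where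
  "out_sym q (Letter x) = (if q = 1 \<or> q = 4 then encode x else 1)"
| "out_sym q _ = 1"

definition next_state :: "nat \<Rightarrow> abc \<Rightarrow> nat" where
  "next_state q x = (if x = Sc \<and> q \<le> 4 then q + 2 else q)"

text \<open>Well-formedness concerns attainable configurations only. So columns may vanish on
  \<open>LeftEnd\<close> outside state 0, and a letter may send two states to the same one, as
  \<open>Sc\<close> does with 3 and 5.\<close>

fun amp :: "nat \<Rightarrow> abc tape_symbol \<Rightarrow> nat \<Rightarrow> complex" where
  "amp q LeftEnd q' = (if q = 0 \<and> (q' = 1 \<or> q' = 2) then half_amp else 0)"
| "amp q (Letter x) q' = (if q' = next_state q x then 1 else 0)"
| "amp q RightEnd q' =
    (if q = 3 then (if q' = 3 \<or> q' = 4 then half_amp else 0)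
     else if q = 4 then (if q' = 3 then half_amp else if q' = 4 then - half_amp else 0)
     else if q' = q then 1 else 0)"

definition twin_machine :: "(nat, abc, nat, nat) rt_qfa_pos" where
  "twin_machine =
    \<lparr> states = {..6}, input_alphabet = {Sa, Sb, Sc}, tape_alphabet = {..3},
      blank_sym = 0, empty_sym = 1, register_alphabet = {0},
      delta = (\<lambda>q \<sigma> q' g om. if g = out_sym q \<sigma> then amp q \<sigma> q' else 0),
      initial = 0, accepting = {3} \<rparr>"

lemma twin_machine_simps [simp]:
  "states twin_machine = {..6}" "input_alphabet twin_machine = {Sa, Sb, Sc}"
  "tape_alphabet twin_machine = {..3}" "blank_sym twin_machine = 0"
  "empty_sym twin_machine = 1" "register_alphabet twin_machine = {0}"
  "delta twin_machine q \<sigma> q' g om = (if g = out_sym q \<sigma> then amp q \<sigma> q' else 0)"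
  "initial twin_machine = 0" "accepting twin_machine = {3}"
  by (simp_all add: twin_machine_def)

lemma half_amp_simps [simp]:
  "half_amp * half_amp = 1 / 2" "cnj half_amp = half_amp" "half_amp \<noteq> 0"
proof -
  have "half_amp * half_amp = complex_of_real ((1 / sqrt 2) * (1 / sqrt 2))"
    unfolding half_amp_def by (simp only: of_real_mult)
  also have "(1 / sqrt 2) * (1 / sqrt 2) = (1 / 2 :: real)" by simp
  finally show "half_amp * half_amp = 1 / 2" by simp
qed (simp_all add: half_amp_def)

lemma out_sym_le_3: "out_sym q \<sigma> \<le> 3"
proof -
  have "encode x \<le> 3" for x by (cases x) auto
  then show ?thesis by (cases \<sigma>) auto
qed

abbreviation put :: "nat \<Rightarrow> nat list \<Rightarrow> nat list" where
  "put \<equiv> push twin_machine"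

lemma put_def: "put g t = (if g = 1 then t else t @ [g])"
  by (simp add: push_def)

text \<open>The written symbol is a function of state and input symbol, so the sum over tape symbols
  collapses to one term, which \<open>out_sym_le_3\<close> places in the tape alphabet.\<close>

lemma E_op_twin:
  "E_op twin_machine w om (q', i', t') (q, i, t) =
    (if q \<le> 6 \<and> q' \<le> 6 \<and> i < length (tilde w) \<and> i' = Suc i \<and> t' = put (out_sym q (tilde w ! i)) t
     then amp q (tilde w ! i) q' else 0)"
proof -
  let ?G = "{g. g \<in> {..3} \<and> put g t = t'}"
  have "finite ?G" by simp
  then have "(\<Sum>g\<in>?G. if g = out_sym q (tilde w ! i) then amp q (tilde w ! i) q' else 0) =
      (if out_sym q (tilde w ! i) \<in> ?G then amp q (tilde w ! i) q' else 0)"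
    by (rule sum.delta)
  then show ?thesis
    using out_sym_le_3[of q "tilde w ! i"] by (auto simp: E_op_def)
qed

section \<open>The two branches\<close>

definition branch_step :: "abc \<Rightarrow> nat \<times> nat list \<Rightarrow> nat \<times> nat list" where
  "branch_step x = (\<lambda>(q, t). (next_state q x, put (out_sym q (Letter x)) t))"

definition branch :: "nat \<Rightarrow> abc list \<Rightarrow> nat \<times> nat list" where
  "branch q w = fold branch_step w (q, [])"

text \<open>\<open>k\<close> counts letters only; the left end-marker has been read too, hence the
  position \<open>Suc k\<close>.\<close>

definition branch_config :: "abc list \<Rightarrow> nat \<Rightarrow> nat \<Rightarrow> (nat, nat) config" where
  "branch_config w q k = (fst (branch q (take k w)), Suc k, snd (branch q (take k w)))"

lemma branch_snoc: "branch q (w @ [x]) = branch_step x (branch q w)"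
  by (simp add: branch_def)

text \<open>Both branches read the same letters and move in lockstep. Odd states against even ones
  keep the branches apart even when their tapes agree.\<close>

lemma branch_states:
  "fst (branch 1 w) \<in> {1, 3, 5} \<and> fst (branch 2 w) = Suc (fst (branch 1 w))"
proof (induction w rule: rev_induct)
  case Nil
  then show ?case by (simp add: branch_def)
next
  case (snoc x w)
  then show ?case
    by (auto simp: branch_snoc branch_step_def next_state_def split: prod.splits)
qed

lemma branch_state_le_6:
  assumes "q \<in> {1, 2}"
  shows "fst (branch q w) \<le> 6"
  using branch_states[of w] assms by auto

lemma fold_branch_step_no_c:
  assumes "Sc \<notin> set u"
  shows "fold branch_step u (q, t) = (q, t @ (if q = 1 \<or> q = 4 then map encode u else []))"
  using assms
proof (induction u arbitrary: t)
  case (Cons x u)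
  \<comment> \<open>A letter other than \<open>Sc\<close> is not encoded by the empty symbol, so
    pushing it really lengthens the tape.\<close>
  then have "encode x \<noteq> 1" "x \<noteq> Sc" by (cases x; simp)+
  with Cons show ?case by (auto simp: branch_step_def next_state_def put_def)
qed simp

lemma fst_fold_branch_step_sink:
  "q > 4 \<Longrightarrow> fst (fold branch_step u (q, t)) = q"
  by (induction u arbitrary: t) (auto simp: branch_step_def next_state_def)

lemma branch_no_c:
  assumes "Sc \<notin> set u"
  shows "fst (branch 1 u) = 1"
  using assms by (simp add: branch_def fold_branch_step_no_c)

lemma branch_one_c:
  assumes "Sc \<notin> set u" "Sc \<notin> set v"
  shows "branch 1 (u @ Sc # v) = (3, map encode u)" "branch 2 (u @ Sc # v) = (4, map encode v)"
  using assms
  by (simp_all add: branch_def fold_branch_step_no_c branch_step_def next_state_def put_def)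

lemma branch_two_c:
  assumes "Sc \<notin> set u" "Sc \<notin> set v"
  shows "fst (branch 1 (u @ Sc # v @ Sc # x)) = 5"
  using assms
  by (simp add: branch_def fold_branch_step_no_c branch_step_def next_state_def put_def
      fst_fold_branch_step_sink)

lemma inj_encode: "inj encode"
proof (rule injI)
  fix x y assume "encode x = encode y"
  then show "x = y" by (cases x; cases y) auto
qed

lemma branch_1_eq_3_iff:
  "fst (branch 1 w) = 3 \<longleftrightarrow> (\<exists>u v. w = u @ Sc # v \<and> Sc \<notin> set u \<and> Sc \<notin> set v)"
proof
  assume *: "fst (branch 1 w) = 3"
  then have "Sc \<in> set w" using branch_no_c by force
  then obtain u v where w: "w = u @ Sc # v" "Sc \<notin> set u" by (meson split_list_first)
  have "Sc \<notin> set v"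
  proof
    assume "Sc \<in> set v"
    then obtain v' x where "v = v' @ Sc # x" "Sc \<notin> set v'" by (meson split_list_first)
    with * w branch_two_c[of u v' x] show False by simp
  qed
  with w show "\<exists>u v. w = u @ Sc # v \<and> Sc \<notin> set u \<and> Sc \<notin> set v" by blast
qed (use branch_one_c in auto)

lemma lists_ab_iff: "u \<in> lists {Sa, Sb} \<longleftrightarrow> Sc \<notin> set u"
proof -
  have "x \<in> {Sa, Sb} \<longleftrightarrow> x \<noteq> Sc" for x by (cases x) auto
  then show ?thesis unfolding in_lists_conv_set by auto
qed

text \<open>State 3 certifies exactly one \<open>Sc\<close>. The tapes then hold the encoded parts
  before and after it, and \<open>encode\<close> is injective.\<close>

lemma L_twin_iff_branch:
  "w \<in> L_twin \<longleftrightarrow> fst (branch 1 w) = 3 \<and> snd (branch 1 w) = snd (branch 2 w)"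
proof
  assume "w \<in> L_twin"
  then obtain u where "w = u @ Sc # u" "Sc \<notin> set u"
    by (auto simp: L_twin_def lists_ab_iff)
  then show "fst (branch 1 w) = 3 \<and> snd (branch 1 w) = snd (branch 2 w)"
    by (simp add: branch_one_c del: One_nat_def)
next
  assume *: "fst (branch 1 w) = 3 \<and> snd (branch 1 w) = snd (branch 2 w)"
  then obtain u v where w: "w = u @ Sc # v" "Sc \<notin> set u" "Sc \<notin> set v"
    using branch_1_eq_3_iff by blast
  with * have "map encode u = map encode v" by (simp add: branch_one_c del: One_nat_def)
  then have "u = v" using inj_encode by simp
  with w show "w \<in> L_twin" by (auto simp: L_twin_def lists_ab_iff)
qed

section \<open>Columns of the transition matrix\<close>

abbreviation ket :: "'c \<Rightarrow> 'c \<Rightarrow> complex" where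
  "ket a \<equiv> (\<lambda>z. if z = a then 1 else 0)"

lemma length_tilde [simp]: "length (tilde w) = Suc (Suc (length w))"
  by (simp add: tilde_def)

lemma nth_tilde [simp]:
  "tilde w ! 0 = LeftEnd"
  "k < length w \<Longrightarrow> tilde w ! Suc k = Letter (w ! k)"
  "tilde w ! Suc (length w) = RightEnd"
  by (simp_all add: tilde_def nth_append)

text \<open>The branch \<open>q\<close> enters only through its tape. Branches with equal tapes
  therefore share these configurations, which is what lets them interfere.\<close>

abbreviation end_config :: "abc list \<Rightarrow> nat \<Rightarrow> nat \<Rightarrow> (nat, nat) config" where
  "end_config w q q' \<equiv> (q', Suc (Suc (length w)), snd (branch q w))"

lemma E_op_initial:
  "E_op twin_machine w om z (initial_config twin_machine) =
    half_amp * ket (branch_config w 1 0) z + half_amp * ket (branch_config w 2 0) z"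
proof -
  obtain q i t where "z = (q, i, t)" by (rule prod_cases3)
  then show ?thesis
    by (auto simp: initial_config_def E_op_twin branch_config_def branch_def put_def)
qed

lemma E_op_branch:
  assumes "q \<in> {1, 2}" "k < length w"
  shows "E_op twin_machine w om z (branch_config w q k) = ket (branch_config w q (Suc k)) z"
proof -
  obtain q' i t where z: "z = (q', i, t)" by (rule prod_cases3)
  obtain p s where now: "branch q (take k w) = (p, s)" by fastforce
  have "branch q (take (Suc k) w) = branch_step (w ! k) (branch q (take k w))"
    using assms(2) by (simp add: take_Suc_conv_app_nth branch_snoc)
  then have later:
    "branch q (take (Suc k) w) = (next_state p (w ! k), put (out_sym p (Letter (w ! k))) s)"
    by (simp add: now branch_step_def)
  have "p \<le> 6" "next_state p (w ! k) \<le> 6"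
    using branch_state_le_6[OF assms(1), of "take k w"] branch_state_le_6[OF assms(1), of "take (Suc k) w"]
    by (simp_all add: now later)
  then show ?thesis using assms(2)
    by (auto simp: z E_op_twin branch_config_def now later)
qed

lemma E_op_end:
  assumes "q \<in> {1, 2}"
  shows "E_op twin_machine w om z (branch_config w q (length w)) =
    (if fst (branch q w) = 3 then half_amp * ket (end_config w q 3) z + half_amp * ket (end_config w q 4) z
     else if fst (branch q w) = 4
       then half_amp * ket (end_config w q 3) z + (- half_amp) * ket (end_config w q 4) z
     else ket (end_config w q (fst (branch q w))) z)"
proof -
  obtain q' i t where z: "z = (q', i, t)" by (rule prod_cases3)
  have "fst (branch q w) \<le> 6"
    using assms branch_state_le_6 by blast
  then show ?thesis
    by (auto simp: z E_op_twin branch_config_def put_def)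
qed

section \<open>Attainable configurations\<close>

text \<open>An upper bound is enough here: \<open>q'\<close> ranges over all states, whether or not
  the configuration is really reached.\<close>

lemma attainable_cases:
  assumes "c \<in> attainable twin_machine w"
  shows "c = initial_config twin_machine \<or> (\<exists>q\<in>{1, 2}. \<exists>k\<le>length w. c = branch_config w q k) \<or>
    (\<exists>q\<in>{1, 2}. \<exists>q'\<le>6. c = end_config w q q')"
  using assms
proof induction
  case (step c om c')
  consider (init) "c = initial_config twin_machine"
    | (branch) q k where "q \<in> {1, 2}" "k < length w" "c = branch_config w q k"
    | (final) q where "q \<in> {1, 2}" "c = branch_config w q (length w)"
    | (stop) q q' where "c = end_config w q q'"
    using step.IH by (metis le_neq_implies_less)
  then show ?case
  proof cases
    case init
    then show ?thesis using step.hyps(3) by (auto simp: E_op_initial split: if_splits)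
  next
    case branch
    then have "c' = branch_config w q (Suc k)"
      using step.hyps(3) by (auto simp: E_op_branch split: if_splits)
    with branch show ?thesis
      by (intro disjI2 disjI1 bexI[of _ q] exI[of _ "Suc k"]) auto
  next
    case final
    then have "\<exists>q'\<le>6. c' = end_config w q q'"
      using step.hyps(3) branch_state_le_6[of q w] by (auto simp: E_op_end split: if_splits)
    with final show ?thesis by blast
  next
    \<comment> \<open>The whole tape has been read, so this column is zero.\<close>
    case stop
    then show ?thesis using step.hyps(3) by (cases c') (simp add: E_op_twin)
  qed
qed simp

text \<open>The general \<open>finite_attainable\<close> presupposes \<open>is_rt_qfa_pos\<close>,
  whose proof for this machine already uses finiteness.\<close>

lemma finite_attainable_twin: "finite (attainable twin_machine w)"
proof (rule finite_subset)
  show "attainable twin_machine w \<subseteq> {initial_config twin_machine} \<union>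
      (\<lambda>(q, k). branch_config w q k) ` ({1, 2} \<times> {..length w}) \<union>
      (\<lambda>(q, q'). end_config w q q') ` ({1, 2} \<times> {..6})"
    using attainable_cases by fastforce
qed simp

lemma attainable_step:
  assumes "c \<in> attainable twin_machine w" "E_op twin_machine w 0 c' c \<noteq> 0"
  shows "c' \<in> attainable twin_machine w"
  using assms attainable.step[of c twin_machine w 0 c'] by simp

lemma attainable_initial [simp]: "initial_config twin_machine \<in> attainable twin_machine w"
  by (rule attainable.init)

lemma branch_config_neq: "branch_config w 1 k \<noteq> branch_config w 2 l"
proof
  assume "branch_config w 1 k = branch_config w 2 l"
  then have "k = l" "fst (branch 1 (take k w)) = fst (branch 2 (take l w))"
    by (auto simp: branch_config_def)
  then show False using branch_states[of "take k w"] by simp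
qed

text \<open>Matrix products sum over attainable configurations, so a \<open>ket\<close> contributes
  only once its membership is known.\<close>

lemma attainable_branch:
  assumes "q \<in> {1, 2}" "k \<le> length w"
  shows "branch_config w q k \<in> attainable twin_machine w"
  using assms(2)
proof (induction k)
  case 0
  show ?case
    by (rule attainable_step[OF attainable_initial])
      (use assms(1) branch_config_neq[of w 0 0] in \<open>auto simp: E_op_initial\<close>)
next
  case (Suc k)
  show ?case
    by (rule attainable_step[of "branch_config w q k"])
      (use Suc assms(1) in \<open>auto simp: E_op_branch\<close>)
qed

lemma attainable_end:
  assumes "q \<in> {1, 2}" "E_op twin_machine w 0 z (branch_config w q (length w)) \<noteq> 0"
  shows "z \<in> attainable twin_machine w"
  using attainable_step[OF attainable_branch[OF assms(1) le_refl] assms(2)] .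

section \<open>Well-formedness\<close>

text \<open>Inner product of two vectors, by orthonormality of the \<open>ket\<close> basis. The
  labels may coincide, in which case amplitudes add up; this covers interference.\<close>

lemma sum_ket_products:
  assumes "finite C" "a \<in> C" "b \<in> C" "a' \<in> C" "b' \<in> C"
  shows "(\<Sum>z\<in>C. cnj (x * ket a z + y * ket b z) * (x' * ket a' z + y' * ket b' z)) =
    cnj x * x' * ket a a' + cnj x * y' * ket a b' + cnj y * x' * ket b a' + cnj y * y' * ket b b'"
proof -
  have *: "(\<Sum>z\<in>C. u * (ket p z * ket r z)) = u * ket p r" if "p \<in> C" for p r u
  proof -
    have "(\<Sum>z\<in>C. u * (ket p z * ket r z)) = (\<Sum>z\<in>C. if z = p then u * ket p r else 0)"
      by (rule sum.cong) auto
    also have "\<dots> = u * ket p r" using assms(1) that by simp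
    finally show ?thesis .
  qed
  have "(\<Sum>z\<in>C. cnj (x * ket a z + y * ket b z) * (x' * ket a' z + y' * ket b' z)) =
    (\<Sum>z\<in>C. cnj x * x' * (ket a z * ket a' z) + cnj x * y' * (ket a z * ket b' z)
       + cnj y * x' * (ket b z * ket a' z) + cnj y * y' * (ket b z * ket b' z))"
    by (rule sum.cong) (auto simp: algebra_simps)
  also have "\<dots> = cnj x * x' * ket a a' + cnj x * y' * ket a b' + cnj y * x' * ket b a'
      + cnj y * y' * ket b b'"
    using assms by (simp only: sum.distrib *)
  finally show ?thesis .
qed

text \<open>An entry of the adjoint of E times E, where E belongs to the only register symbol
  0.\<close>

abbreviation column_product :: "abc list \<Rightarrow> (nat, nat) config \<Rightarrow> (nat, nat) config \<Rightarrow> complex" where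
  "column_product w c d \<equiv>
    (\<Sum>z\<in>attainable twin_machine w. cnj (E_op twin_machine w 0 z c) * E_op twin_machine w 0 z d)"

lemma column_product_initial:
  "column_product w (initial_config twin_machine) (initial_config twin_machine) = 1"
proof -
  have mem: "branch_config w 1 0 \<in> attainable twin_machine w"
    "branch_config w 2 0 \<in> attainable twin_machine w"
    by (simp_all add: attainable_branch)
  show ?thesis
    unfolding E_op_initial sum_ket_products[OF finite_attainable_twin mem mem]
    using branch_config_neq[of w 0 0] by simp
qed

lemma column_product_branch:
  assumes "q \<in> {1, 2}" "r \<in> {1, 2}" "k < length w"
  shows "column_product w (branch_config w q k) (branch_config w r k) = (if q = r then 1 else 0)"
proof -
  have "branch_config w q (Suc k) = branch_config w r (Suc k) \<longleftrightarrow> q = r"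
    using assms branch_config_neq[of w "Suc k" "Suc k"] by auto
  \<comment> \<open>A zero second term brings single kets into the form of
    \<open>sum_ket_products\<close>.\<close>
  moreover have "column_product w (branch_config w q k) (branch_config w r k) =
    (\<Sum>z\<in>attainable twin_machine w. cnj (1 * ket (branch_config w q (Suc k)) z + 0 * ket (branch_config w q (Suc k)) z)
       * (1 * ket (branch_config w r (Suc k)) z + 0 * ket (branch_config w r (Suc k)) z))"
    using assms by (intro sum.cong) (auto simp: E_op_branch)
  ultimately show ?thesis
    using assms by (subst (asm) sum_ket_products) (auto simp: finite_attainable_twin attainable_branch)
qed

lemma E_op_end_one_c:
  assumes "fst (branch 1 w) = 3"
  shows "E_op twin_machine w om z (branch_config w 1 (length w)) =
      half_amp * ket (end_config w 1 3) z + half_amp * ket (end_config w 1 4) z"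
    and "E_op twin_machine w om z (branch_config w 2 (length w)) =
      half_amp * ket (end_config w 2 3) z + (- half_amp) * ket (end_config w 2 4) z"
  using assms branch_states[of w] by (auto simp: E_op_end)

lemma E_op_end_other:
  assumes "fst (branch 1 w) \<noteq> 3" "q \<in> {1, 2}"
  shows "E_op twin_machine w om z (branch_config w q (length w)) =
    ket (end_config w q (fst (branch q w))) z"
  using assms branch_states[of w] by (auto simp: E_op_end)

lemma attainable_end_one_c:
  assumes "fst (branch 1 w) = 3" "q \<in> {1, 2}" "q' \<in> {3, 4}"
  shows "end_config w q q' \<in> attainable twin_machine w"
  using assms by (intro attainable_end[OF assms(2)]) (auto simp: E_op_end_one_c simp del: One_nat_def)

lemma attainable_end_other:
  assumes "fst (branch 1 w) \<noteq> 3" "q \<in> {1, 2}"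
  shows "end_config w q (fst (branch q w)) \<in> attainable twin_machine w"
  using assms by (intro attainable_end[OF assms(2)]) (simp add: E_op_end_other)

lemma column_product_end:
  assumes "q \<in> {1, 2}" "r \<in> {1, 2}"
  shows "column_product w (branch_config w q (length w)) (branch_config w r (length w)) =
    (if q = r then 1 else 0)"
proof (cases "fst (branch 1 w) = 3")
  case True
  \<comment> \<open>For different branches, equal tapes give 1/2 - 1/2 = 0 by the sign in the
    Hadamard matrix, and different tapes give disjoint supports.\<close>
  have products:
    "column_product w (branch_config w 1 (length w)) (branch_config w 1 (length w)) = 1"
    "column_product w (branch_config w 1 (length w)) (branch_config w 2 (length w)) = 0"
    "column_product w (branch_config w 2 (length w)) (branch_config w 1 (length w)) = 0"
    "column_product w (branch_config w 2 (length w)) (branch_config w 2 (length w)) = 1"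
    unfolding E_op_end_one_c[OF True]
    by (subst sum_ket_products;
        auto simp: finite_attainable_twin attainable_end_one_c[OF True])+
  show ?thesis using assms products by auto
next
  case False
  let ?e = "\<lambda>q. end_config w q (fst (branch q w))"
  have "column_product w (branch_config w q (length w)) (branch_config w r (length w)) =
    (\<Sum>z\<in>attainable twin_machine w.
       cnj (1 * ket (?e q) z + 0 * ket (?e q) z) * (1 * ket (?e r) z + 0 * ket (?e r) z))"
    using assms by (intro sum.cong) (auto simp: E_op_end_other[OF False])
  also have "\<dots> = ket (?e q) (?e r)"
    using assms
    by (subst sum_ket_products) (auto simp: finite_attainable_twin attainable_end_other[OF False])
  \<comment> \<open>By \<open>branch_states\<close> the final states of the two branches differ,
    whatever the tapes.\<close>
  also have "\<dots> = (if q = r then 1 else 0)"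
    using assms branch_states[of w] by auto
  finally show ?thesis .
qed

text \<open>Each step advances the input head by one, so these columns have disjoint
  supports.\<close>

lemma column_product_position:
  assumes "fst (snd c) \<noteq> fst (snd d)"
  shows "column_product w c d = 0"
proof (rule sum.neutral, rule ballI)
  fix z
  have "fst (snd z) = Suc (fst (snd e))" if "E_op twin_machine w 0 z e \<noteq> 0"
    for e
    using that by (cases z; cases e) (auto simp: E_op_twin split: if_splits)
  then have "E_op twin_machine w 0 z c = 0 \<or> E_op twin_machine w 0 z d = 0"
    using assms by (metis nat.inject)
  then show "cnj (E_op twin_machine w 0 z c) * E_op twin_machine w 0 z d = 0"
    by auto
qed

lemma attainable_position_cases:
  assumes "c \<in> attainable twin_machine w" "fst (snd c) < length (tilde w)"
  obtains "c = initial_config twin_machine"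
  | q k where "q \<in> {1, 2}" "k \<le> length w" "c = branch_config w q k"
  using attainable_cases[OF assms(1)] assms(2) by fastforce

lemma fst_snd_config [simp]:
  "fst (snd (initial_config twin_machine)) = 0"
  "fst (snd (branch_config w q k)) = Suc k"
  by (simp_all add: initial_config_def branch_config_def)

text \<open>At equal positions few pairs remain: position 0 has only the initial configuration, and
  position \<open>Suc k\<close> only the two branches.\<close>

lemma column_product_orthonormal:
  assumes "c \<in> attainable twin_machine w" "fst (snd c) < length (tilde w)"
    and "d \<in> attainable twin_machine w" "fst (snd d) < length (tilde w)"
  shows "column_product w c d = (if c = d then 1 else 0)"
proof (cases "fst (snd c) = fst (snd d)")
  case False
  then show ?thesis using column_product_position by auto
next
  case pos: True
  from assms(1,2) show ?thesis
  proof (cases rule: attainable_position_cases)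
    case 1
    have "d = initial_config twin_machine"
      using assms(3,4) by (cases rule: attainable_position_cases) (use pos 1 in auto)
    with 1 show ?thesis using column_product_initial by simp
  next
    case (2 q k)
    obtain r where r: "r \<in> {1, 2}" "d = branch_config w r k"
      using assms(3,4) by (cases rule: attainable_position_cases) (use pos 2 in auto)
    have "branch_config w q k = branch_config w r k \<longleftrightarrow> q = r"
      using 2 r branch_config_neq[of w k k] by auto
    then show ?thesis
      using 2 r column_product_branch[of q r k w] column_product_end[of q r w]
      by (cases "k = length w") auto
  qed
qed

lemma is_rt_qfa_pos_twin: "is_rt_qfa_pos twin_machine"
proof -
  have "well_formed twin_machine"
    unfolding well_formed_def
  proof (intro ballI impI)
    fix w c d
    assume "c \<in> attainable twin_machine w" "d \<in> attainable twin_machine w"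
      "fst (snd c) < length (tilde w)" "fst (snd d) < length (tilde w)"
    then have "column_product w c d = (if c = d then 1 else 0)"
      by (intro column_product_orthonormal)
    then show "(\<Sum>om\<in>register_alphabet twin_machine. mat_mul (attainable twin_machine w)
        (adjoint (E_op twin_machine w om)) (E_op twin_machine w om) c d) = (if c = d then 1 else 0)"
      by (simp only: twin_machine_simps mat_mul_def adjoint_def sum.insert_if sum.empty finite.emptyI
          empty_iff if_False add_0_right)
  qed
  then show ?thesis by (simp add: is_rt_qfa_pos_def)
qed

section \<open>Evolution of the pure state\<close>

definition pure :: "('c \<Rightarrow> complex) \<Rightarrow> 'c \<Rightarrow> 'c \<Rightarrow> complex" where
  "pure \<psi> = (\<lambda>c d. \<psi> c * cnj (\<psi> d))"

text \<open>With a single Kraus operator E, the rank-one matrix of \<open>\<psi>\<close> is sent to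
  that of E applied to \<open>\<psi>\<close>, so it suffices to follow vectors.\<close>

lemma evolve_pure:
  assumes "register_alphabet M = {om}"
  shows "evolve M w (pure \<psi>) = pure (\<lambda>c. \<Sum>z\<in>attainable M w. E_op M w om c z * \<psi> z)"
proof (intro ext)
  fix c d
  let ?A = "attainable M w" and ?E = "E_op M w om"
  have "evolve M w (pure \<psi>) c d = (\<Sum>z\<in>?A. (\<Sum>y\<in>?A. ?E c y * \<psi> y) * (cnj (\<psi> z) * cnj (?E d z)))"
    by (simp add: evolve_def assms mat_mul_def adjoint_def pure_def)
      (simp only: sum_distrib_right mult.assoc)
  also have "\<dots> = (\<Sum>y\<in>?A. ?E c y * \<psi> y) * (\<Sum>z\<in>?A. cnj (\<psi> z) * cnj (?E d z))"
    by (simp only: sum_distrib_left)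
  also have "\<dots> = pure (\<lambda>c. \<Sum>z\<in>?A. ?E c z * \<psi> z) c d"
    by (simp add: pure_def mult_ac)
  finally show "evolve M w (pure \<psi>) c d = pure (\<lambda>c. \<Sum>z\<in>?A. ?E c z * \<psi> z) c d" .
qed

lemma sum_mult_kets:
  fixes f :: "'c \<Rightarrow> complex"
  assumes "finite C" "a \<in> C" "b \<in> C"
  shows "(\<Sum>z\<in>C. f z * (x * ket a z + y * ket b z)) = x * f a + y * f b"
proof -
  have "(\<Sum>z\<in>C. f z * (x * ket a z + y * ket b z)) =
      (\<Sum>z\<in>C. (if z = a then x * f a else 0) + (if z = b then y * f b else 0))"
    by (rule sum.cong) (auto simp: algebra_simps)
  then show ?thesis using assms by (simp add: sum.distrib)
qed

definition branch_state :: "abc list \<Rightarrow> nat \<Rightarrow> (nat, nat) config \<Rightarrow> complex" where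
  "branch_state w k = (\<lambda>z. half_amp * ket (branch_config w 1 k) z + half_amp * ket (branch_config w 2 k) z)"

lemma evolve_initial:
  "evolve twin_machine w (initial_density twin_machine) = pure (branch_state w 0)"
proof -
  let ?i = "initial_config twin_machine"
  have "initial_density twin_machine = pure (ket ?i)"
    by (auto simp: initial_density_def pure_def fun_eq_iff)
  moreover have "(\<Sum>z\<in>attainable twin_machine w. E_op twin_machine w 0 c z * ket ?i z) = branch_state w 0 c" for c
    using sum_mult_kets[of "attainable twin_machine w" ?i ?i "E_op twin_machine w 0 c" 1 0]
    by (simp add: finite_attainable_twin E_op_initial branch_state_def)
  ultimately show ?thesis by (simp add: evolve_pure)
qed

lemma evolve_branch_state:
  assumes "k \<le> length w"
  shows "evolve twin_machine w (pure (branch_state w k)) =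
    pure (\<lambda>c. half_amp * E_op twin_machine w 0 c (branch_config w 1 k)
            + half_amp * E_op twin_machine w 0 c (branch_config w 2 k))"
  unfolding branch_state_def
  by (subst evolve_pure, simp, subst sum_mult_kets)
    (use assms in \<open>auto simp: finite_attainable_twin attainable_branch\<close>)

text \<open>The extra step in \<open>Suc k\<close> is the one on the left end-marker, which creates
  the superposition.\<close>

lemma evolve_steps:
  "k \<le> length w \<Longrightarrow>
    (evolve twin_machine w ^^ Suc k) (initial_density twin_machine) = pure (branch_state w k)"
proof (induction k)
  case 0
  show ?case by (simp add: evolve_initial)
next
  case (Suc k)
  then have "(evolve twin_machine w ^^ Suc (Suc k)) (initial_density twin_machine) =
      evolve twin_machine w (pure (branch_state w k))"
    by simp
  also have "\<dots> = pure (branch_state w (Suc k))"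
    using Suc.prems by (subst evolve_branch_state) (simp_all add: E_op_branch branch_state_def)
  finally show ?case .
qed

lemma final_density_twin:
  "final_density twin_machine w =
    pure (\<lambda>c. half_amp * E_op twin_machine w 0 c (branch_config w 1 (length w))
            + half_amp * E_op twin_machine w 0 c (branch_config w 2 (length w)))"
  using evolve_steps[of "length w" w] evolve_branch_state[of "length w" w]
  by (simp add: final_density_def)

section \<open>Acceptance probabilities\<close>

abbreviation accepted_configs :: "abc list \<Rightarrow> (nat, nat) config set" where
  "accepted_configs w \<equiv> {c \<in> attainable twin_machine w. fst c = 3}"

lemma finite_accepted_configs: "finite (accepted_configs w)"
  using finite_attainable_twin by simp

text \<open>The branches end in 1 and 2 or in 5 and 6, and the right end-marker fixes these
  states.\<close>

lemma accept_prob_other: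
  assumes "fst (branch 1 w) \<noteq> 3"
  shows "accept_prob twin_machine w = 0"
proof -
  have "final_density twin_machine w c c = 0" if "fst c = 3" for c
    using that assms branch_states[of w]
    by (auto simp: final_density_twin pure_def E_op_end_other)
  then show ?thesis by (simp add: accept_prob_def)
qed

text \<open>Each branch brings amplitude 1/2 to its configuration in state 3. If the two coincide,
  the amplitude is 1; otherwise the probabilities 1/4 and 1/4 add up.\<close>

lemma accept_prob_one_c:
  assumes "fst (branch 1 w) = 3"
  shows "accept_prob twin_machine w = (if snd (branch 1 w) = snd (branch 2 w) then 1 else 1 / 2)"
proof -
  let ?a = "end_config w 1 3" and ?b = "end_config w 2 3"
  have mem: "?a \<in> accepted_configs w" "?b \<in> accepted_configs w"
    using attainable_end_one_c[OF assms] by auto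
  \<comment> \<open>The kets in state 4 vanish at \<open>c\<close>. Writing the diagonal entry as a
    squared modulus makes the total an instance of \<open>sum_ket_products\<close>.\<close>
  have "final_density twin_machine w c c =
      cnj (1 / 2 * ket ?a c + 1 / 2 * ket ?b c) * (1 / 2 * ket ?a c + 1 / 2 * ket ?b c)"
    if "fst c = 3" for c
    using that unfolding final_density_twin pure_def E_op_end_one_c[OF assms]
    by (cases "c = ?a"; cases "c = ?b") (auto simp: algebra_simps)
  then have "(\<Sum>c\<in>accepted_configs w. final_density twin_machine w c c) =
      (\<Sum>c\<in>accepted_configs w.
         cnj (1 / 2 * ket ?a c + 1 / 2 * ket ?b c) * (1 / 2 * ket ?a c + 1 / 2 * ket ?b c))"
    by (intro sum.cong) auto
  also have "\<dots> = (if snd (branch 1 w) = snd (branch 2 w) then 1 else 1 / 2)"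
    by (subst sum_ket_products[OF finite_accepted_configs mem mem]) auto
  finally show ?thesis by (simp add: accept_prob_def)
qed

lemma recognizes_twin: "recognizes_neg_one_sided twin_machine L_twin (1 / 2)"
proof -
  have "x \<in> {Sa, Sb, Sc}" for x by (cases x) auto
  then have "lists {Sa, Sb, Sc} = UNIV" by auto
  moreover have "accept_prob twin_machine w = 1" if "w \<in> L_twin" for w
    using that accept_prob_one_c[of w] by (simp only: L_twin_iff_branch simp_thms if_True)
  moreover have "accept_prob twin_machine w \<le> 1 / 2" if "w \<notin> L_twin" for w
    using that accept_prob_one_c[of w] accept_prob_other[of w]
    by (cases "fst (branch 1 w) = 3") (auto simp: L_twin_iff_branch)
  ultimately show ?thesis
    by (simp add: recognizes_neg_one_sided_def)
qed

theorem theorem5: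
  "\<exists>M :: (nat, abc, nat, nat) rt_qfa_pos.
     is_rt_qfa_pos M \<and> input_alphabet M = {Sa, Sb, Sc} \<and>
     recognizes_neg_one_sided M L_twin (1 / 2)"
  using is_rt_qfa_pos_twin recognizes_twin twin_machine_simps(2) by blast

end
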